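(* Let $(G,B,m,w)$ be a connected weighted finite graph with boundary, where $G=(V,E)$. Let $\sigma_2$ be its second Steklov eigenvalue. Then $$\sigma_2\;\geq\;\frac{w_0\,V_B}{(V_B-m_0)^2\,d_B},$$ where $V_B=\sum_{x\in B}m_x$, $m_0=\min_{x\in B}m_x$, $w_0=\min_{e\in E}w_e$ and $d_B=\max\{d(x,y) : x,y\in B\}$.
   Context: A weighted graph with boundary is a quadruple $(G,B,m,w)$ where $G=(V,E)$ is a simple graph, $B\subset V$ (the boundary), $m:V\to(0,\infty)$ is the vertex-measure and $w:E\to(0,\infty)$ is the edge-weight. It is a connected finite one if $G$ is finite and connected. Edges between boundary vertices are allowed. Put $\Omega=V\setminus B$ (the interior). Extend $w$ to a symmetric function on $V\times V$ by $w_{xy}=w(\{x,y\})$ if $\{x,y\}\in E$ and $w_{xy}=0$ otherwise. The distance $d(x,y)$ is the combinatorial graph distance (the least number of edges in a path from $x$ to $y$). The Laplacian of $u:V\to\mathbb{R}$ is $\Delta u(x)=\frac{1}{m_x}\sum_{y\in V}(u(y)-u(x))w_{xy}$ for $x\in V$. For $x\in B$ the outward normal derivative is $\frac{\partial u}{\partial n}(x)=\frac{1}{m_x}\sum_{y\in V}(u(x)-u(y))w_{xy}=-\Delta u(x)$. For $f\in\mathbb{R}^B$ let $u_f:V\to\mathbb{R}$ be the harmonic extension of $f$, i.e. the function with $u_f=f$ on $B$ and $\Delta u_f=0$ on $\Omega$. The Steklov operator $\Lambda:\mathbb{R}^B\to\mathbb{R}^B$ is $\Lambda(f)=\frac{\partial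 u_f}{\partial n}$. It is self-adjoint and nonnegative for the inner product $\langle f,g\rangle_B=\sum_{x\in B}f(x)g(x)m_x$, and its eigenvalues, listed with multiplicity, are $0=\sigma_1<\sigma_2\le\cdots\le\sigma_{|B|}$, the Steklov eigenvalues. One has $$\sigma_2=\min\left\{\frac{\sum_{\{x,y\}\in E}(u_f(x)-u_f(y))^2w_{xy}}{\sum_{x\in B}f(x)^2m_x} : 0\ne f\in\mathbb{R}^B,\ \sum_{x\in B}f(x)m_x=0\right\}.$$ By convention $\sigma_i=+\infty$ for $i>|B|$; in particular $\sigma_2=+\infty$ when $|B|\le 1$, and in that case the inequality is regarded as trivially true. *)

theory Defs
  imports "HOL-Analysis.Analysis" "HOL-Library.Function_Algebras"
begin

text \<open>
  Real functions on a finite subset \<open>S\<close> of the type \<open>'a\<close> are represented by the functions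
  \<open>'a \<Rightarrow> real\<close> that vanish outside \<open>S\<close>. The library has no real vector space instance for
  function types, so linear algebra on them goes through the locale of vector spaces.
\<close>

global_interpretation fun_real: vector_space "\<lambda>(c::real) (f::'a \<Rightarrow> real) x. c * f x"
  defines fun_dim = fun_real.dim
  by unfold_locales (auto simp: fun_eq_iff plus_fun_def algebra_simps)

definition supported_funs :: "'a set \<Rightarrow> ('a \<Rightarrow> real) set" where
  "supported_funs S = {f. \<forall>x. x \<notin> S \<longrightarrow> f x = 0}"

locale finite_boundary_graph =
  fixes V :: "'a set" and E :: "'a set set" and B :: "'a set"
    and m :: "'a \<Rightarrow> real" and w :: "'a set \<Rightarrow> real"
  assumes finite_V: "finite V"
    and edgeE: "e \<in> E \<Longrightarrow> \<exists>x\<in>V. \<exists>y\<in>V. x \<noteq> y \<and> e = {x, y}"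
    and B_subset: "B \<subseteq> V"
    and m_pos: "x \<in> V \<Longrightarrow> m x > 0"
    and w_pos: "e \<in> E \<Longrightarrow> w e > 0"
begin

definition path_between :: "'a \<Rightarrow> 'a \<Rightarrow> 'a list \<Rightarrow> bool" where
  "path_between x y p \<longleftrightarrow> p \<noteq> [] \<and> hd p = x \<and> last p = y \<and> distinct p \<and> set p \<subseteq> V \<and>
     successively (\<lambda>a b. {a, b} \<in> E) p"

text \<open>The number of edges of a path is one less than its number of vertices.\<close>

definition graph_dist :: "'a \<Rightarrow> 'a \<Rightarrow> nat" where
  "graph_dist x y = (LEAST n. \<exists>p. path_between x y p \<and> n = length p - 1)"

definition weight :: "'a \<Rightarrow> 'a \<Rightarrow> real" where
  "weight x y = (if {x, y} \<in> E then w {x, y} else 0)"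

definition laplacian :: "('a \<Rightarrow> real) \<Rightarrow> 'a \<Rightarrow> real" where
  "laplacian u x = 1 / m x * (\<Sum>y\<in>V. (u y - u x) * weight x y)"

definition normal_derivative :: "('a \<Rightarrow> real) \<Rightarrow> 'a \<Rightarrow> real" where
  "normal_derivative u x = 1 / m x * (\<Sum>y\<in>V. (u x - u y) * weight x y)"

text \<open>The harmonic extension is unique when the graph is connected and \<open>B\<close> is nonempty.\<close>

definition harmonic_extension :: "('a \<Rightarrow> real) \<Rightarrow> 'a \<Rightarrow> real" where
  "harmonic_extension f =
     (THE u. u \<in> supported_funs V \<and> (\<forall>x\<in>B. u x = f x) \<and> (\<forall>x\<in>V - B. laplacian u x = 0))"

definition steklov_op :: "('a \<Rightarrow> real) \<Rightarrow> 'a \<Rightarrow> real" where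
  "steklov_op f x = (if x \<in> B then normal_derivative (harmonic_extension f) x else 0)"

definition steklov_eigenspace :: "real \<Rightarrow> ('a \<Rightarrow> real) set" where
  "steklov_eigenspace \<mu> = {f \<in> supported_funs B. steklov_op f = (\<lambda>x. \<mu> * f x)}"

definition steklov_eigenvalue :: "real \<Rightarrow> bool" where
  "steklov_eigenvalue \<mu> \<longleftrightarrow> (\<exists>f \<in> steklov_eigenspace \<mu>. f \<noteq> 0)"

text \<open>
  The eigenvalues in nondecreasing order, each repeated as often as the dimension of its
  eigenspace. The operator is self-adjoint, so this list has length \<open>card B\<close> if the graph is
  connected and \<open>B\<close> is nonempty.
\<close>

definition steklov_spectrum :: "real list" where
  "steklov_spectrum =
     concat (map (\<lambda>\<mu>. replicate (fun_dim (steklov_eigenspace \<mu>)) \<mu>)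
       (sorted_list_of_set {\<mu>. steklov_eigenvalue \<mu>}))"

text \<open>Numbering starts at 1.\<close>

definition steklov_sigma :: "nat \<Rightarrow> ereal" where
  "steklov_sigma i = (if i \<le> card B then ereal (steklov_spectrum ! (i - 1)) else \<infinity>)"

end

locale finite_connected_boundary_graph = finite_boundary_graph +
  assumes connected: "x \<in> V \<Longrightarrow> y \<in> V \<Longrightarrow> \<exists>p. path_between x y p"

end

(*
  On an eigenfunction with positive eigenvalue the eigenvalue is the Dirichlet energy divided by the
  boundary norm, and the boundary values have mean zero. If their maximum and minimum over B differ
  by h, Cauchy-Schwarz along a shortest path between the two extremal boundary vertices bounds the
  energy from below by w_0 h^2 / d_B, while the variance bound of Popoviciu bounds the boundary norm
  from above by V_B h^2 / 4; since B has two points, m_0 <= V_B / 2 and so V_B / 4 is at most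
  (V_B - m_0)^2 / V_B. That sigma_2 is a positive eigenvalue follows from connectedness, which makes
  0 a simple eigenvalue, and from minimising the energy over normalised mean-zero boundary values.
*)

theory Submission
  imports Defs
begin

text \<open>A quadratic in \<open>s\<close> that is 0 at \<open>s = 0\<close> and never negative has
  derivative 0 there. This is the first-variation argument for the Rayleigh minimiser.\<close>

lemma linear_coefficient_eq_0:
  fixes p q :: real
  assumes "\<And>s. 0 \<le> 2 * s * p + s\<^sup>2 * q"
  shows "p = 0"
proof (rule ccontr)
  assume p: "p \<noteq> 0"
  \<comment> \<open>Exceeding both 0 and \<open>q\<close>, \<open>r\<close> makes
    \<open>q - 2 * r\<close> negative whatever the sign of \<open>q\<close>.\<close>
  define r where "r = \<bar>q\<bar> + 1"
  have r: "r > 0" "q < r" by (auto simp: r_def)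
  have "0 \<le> 2 * (- p / r) * p + (- p / r)\<^sup>2 * q" by (rule assms)
  also have "\<dots> = p\<^sup>2 / r\<^sup>2 * (q - 2 * r)"
    using r by (simp add: field_simps power2_eq_square)
  also have "\<dots> < 0"
    using p r by (intro mult_pos_neg) auto
  finally show False by simp
qed

section \<open>Linear algebra of functions supported in a finite set\<close>

lemma sum_fun_apply: "sum f A x = (\<Sum>a\<in>A. f a x)"
  by (induction A rule: infinite_finite_induct) auto

lemma supported_funs_subset_span:
  assumes "finite S" "f \<in> supported_funs S"
  shows "f \<in> fun_real.span ((\<lambda>b x. if x = b then 1 else 0) ` S)"
proof -
  have "f = (\<Sum>b\<in>S. (\<lambda>x. f b * (if x = b then 1 else 0)))"
    using assms by (auto simp: fun_eq_iff sum_fun_apply supported_funs_def if_distrib cong: if_cong)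
  also have "\<dots> \<in> fun_real.span ((\<lambda>b x. if x = b then 1 else 0) ` S)"
    by (intro fun_real.span_sum fun_real.span_scale fun_real.span_base) auto
  finally show ?thesis .
qed

lemma finite_independent_supported_funs:
  assumes "finite S" "T \<subseteq> supported_funs S" "fun_real.independent T"
  shows "finite T"
  using fun_real.independent_span_bound[of "(\<lambda>b x. if x = b then 1 else 0) ` S" T]
    supported_funs_subset_span assms by blast

text \<open>Ensures that every eigenvalue really occurs in \<open>steklov_spectrum\<close>, where it
  is repeated as often as the dimension of its eigenspace.\<close>

lemma fun_dim_pos:
  assumes "finite S" "U \<subseteq> supported_funs S" "f \<in> U" "f \<noteq> 0"
  shows "0 < fun_dim U"
proof -
  obtain T where T: "T \<subseteq> U" "fun_real.independent T" "U \<subseteq> fun_real.span T" "card T = fun_dim U"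
    by (rule fun_real.basis_exists)
  \<comment> \<open>Finiteness matters because \<open>card\<close> of an infinite basis would be
    0.\<close>
  have "finite T" using finite_independent_supported_funs assms T by blast
  moreover have "T \<noteq> {}" using T assms by auto
  ultimately show ?thesis using T(4) by (metis card_gt_0_iff)
qed

text \<open>Pairing a vanishing combination with one of its members in the weighted inner product
  isolates the coefficient of that member.\<close>

lemma independent_if_orthogonal:
  fixes m :: "'a \<Rightarrow> real"
  assumes T: "T \<subseteq> supported_funs S" "0 \<notin> T"
    and S: "finite S" "\<And>x. x \<in> S \<Longrightarrow> m x > 0"
    and orth: "\<And>f g. f \<in> T \<Longrightarrow> g \<in> T \<Longrightarrow> f \<noteq> g \<Longrightarrow> (\<Sum>x\<in>S. m x * f x * g x) = 0"
  shows "fun_real.independent T"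
  unfolding fun_real.independent_explicit_module
proof (intro allI impI)
  fix t c f assume t: "finite t" "t \<subseteq> T" "(\<Sum>v\<in>t. (\<lambda>x. c v * v x)) = 0" "f \<in> t"
  have 1: "(\<Sum>v\<in>t. c v * v x) = 0" for x
    using fun_cong[OF t(3), of x] by (simp add: sum_fun_apply)
  have "0 = (\<Sum>x\<in>S. m x * f x * (\<Sum>v\<in>t. c v * v x))" by (simp add: 1)
  also have "\<dots> = (\<Sum>x\<in>S. \<Sum>v\<in>t. c v * (m x * f x * v x))"
    by (simp add: sum_distrib_left algebra_simps)
  also have "\<dots> = (\<Sum>v\<in>t. c v * (\<Sum>x\<in>S. m x * f x * v x))"
    by (subst sum.swap) (simp add: sum_distrib_left)
  also have "\<dots> = (\<Sum>v\<in>t. if v = f then c f * (\<Sum>x\<in>S. m x * f x * f x) else 0)"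
    using t orth by (intro sum.cong) auto
  also have "\<dots> = c f * (\<Sum>x\<in>S. m x * f x * f x)" using t by simp
  finally have "c f = 0 \<or> (\<Sum>x\<in>S. m x * f x * f x) = 0" by simp
  moreover have "(\<Sum>x\<in>S. m x * f x * f x) \<noteq> 0"
  proof
    assume "(\<Sum>x\<in>S. m x * f x * f x) = 0"
    moreover have "\<And>x. x \<in> S \<Longrightarrow> 0 \<le> m x * f x * f x"
      using S by (metis less_imp_le mult.assoc mult_nonneg_nonneg zero_le_square)
    ultimately have "\<forall>x\<in>S. m x * f x * f x = 0" using S by (simp add: sum_nonneg_eq_0_iff)
    hence "\<forall>x\<in>S. f x = 0" using S by force
    hence "f x = 0" for x using t(2,4) T(1) by (cases "x \<in> S") (auto simp: supported_funs_def)
    hence "f = 0" by (simp add: fun_eq_iff)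
    thus False using t T by auto
  qed
  ultimately show "c f = 0" by blast
qed

section \<open>Popoviciu's variance inequality\<close>

lemma weighted_variance_bound:
  fixes f m :: "'a \<Rightarrow> real"
  assumes "finite S" "\<And>x. x \<in> S \<Longrightarrow> 0 \<le> m x" "(\<Sum>x\<in>S. m x * f x) = 0"
    and "\<And>x. x \<in> S \<Longrightarrow> a \<le> f x" "\<And>x. x \<in> S \<Longrightarrow> f x \<le> b"
  shows "(\<Sum>x\<in>S. m x * (f x)\<^sup>2) \<le> (\<Sum>x\<in>S. m x) * (b - a)\<^sup>2 / 4"
proof -
  \<comment> \<open>Once expanded, the linear term drops out because the weighted mean is 0.\<close>
  have "0 \<le> (\<Sum>x\<in>S. m x * ((b - f x) * (f x - a)))"
    using assms by (intro sum_nonneg mult_nonneg_nonneg) auto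
  also have "\<dots> = (\<Sum>x\<in>S. (a + b) * (m x * f x) - (m x * (f x)\<^sup>2 + m x * (a * b)))"
    by (intro sum.cong) (auto simp: algebra_simps power2_eq_square)
  also have "\<dots> = (a + b) * (\<Sum>x\<in>S. m x * f x)
      - ((\<Sum>x\<in>S. m x * (f x)\<^sup>2) + (\<Sum>x\<in>S. m x) * (a * b))"
    by (simp only: sum_subtractf sum.distrib sum_distrib_left sum_distrib_right)
  finally have "(\<Sum>x\<in>S. m x * (f x)\<^sup>2) \<le> (\<Sum>x\<in>S. m x) * (- (a * b))"
    using assms(3) by simp
  also have "\<dots> \<le> (\<Sum>x\<in>S. m x) * ((b - a)\<^sup>2 / 4)"
  proof (rule mult_left_mono)
    have "0 \<le> (a + b)\<^sup>2" by simp
    thus "- (a * b) \<le> (b - a)\<^sup>2 / 4" by (simp add: power2_eq_square algebra_simps)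
  qed (use assms in \<open>auto intro: sum_nonneg\<close>)
  finally show ?thesis by simp
qed

section \<open>The Dirichlet form and Green's formula\<close>

context finite_boundary_graph
begin

text \<open>On \<open>V\<close> this is \<open>m x\<close> times the outward normal derivative,
  hence minus \<open>m x\<close> times the Laplacian, so one expression serves interior and
  boundary.\<close>

definition flow :: "('a \<Rightarrow> real) \<Rightarrow> 'a \<Rightarrow> real" where
  "flow u x = (\<Sum>y\<in>V. (u x - u y) * weight x y)"

text \<open>Halved because the sum over ordered pairs meets each edge twice. The bilinear form is
  needed for first variations and orthogonality.\<close>

definition dirichlet :: "('a \<Rightarrow> real) \<Rightarrow> ('a \<Rightarrow> real) \<Rightarrow> real" where
  "dirichlet u v = (\<Sum>x\<in>V. \<Sum>y\<in>V. (u x - u y) * (v x - v y) * weight x y) / 2"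

lemma finite_B: "finite B"
  using B_subset finite_V finite_subset by blast

lemma m_pos_B: "x \<in> B \<Longrightarrow> m x > 0"
  using B_subset m_pos by blast

lemma edge_vertices: "{x, y} \<in> E \<Longrightarrow> x \<in> V \<and> y \<in> V \<and> x \<noteq> y"
  using edgeE by (metis doubleton_eq_iff)

lemma finite_E: "finite E"
proof -
  have "E \<subseteq> Pow V" using edgeE by blast
  thus ?thesis using finite_V by (meson finite_Pow_iff finite_subset)
qed

lemma weight_nonneg: "0 \<le> weight x y"
  using w_pos by (auto simp: weight_def intro: less_imp_le)

lemma weight_commute: "weight x y = weight y x"
  by (simp add: weight_def insert_commute)

lemma weight_self: "weight x x = 0"
  using edge_vertices[of x x] by (auto simp: weight_def)

lemma dirichlet_commute: "dirichlet u v = dirichlet v u"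
  by (simp add: dirichlet_def mult.commute)

text \<open>Green's formula, or summation by parts: split \<open>v x - v y\<close> and swap the
  summation indices in the second half, using the symmetry of the weight.\<close>

lemma dirichlet_eq_flow: "dirichlet u v = (\<Sum>x\<in>V. v x * flow u x)"
proof -
  have "2 * dirichlet u v = (\<Sum>x\<in>V. \<Sum>y\<in>V. v x * ((u x - u y) * weight x y))
      + (\<Sum>x\<in>V. \<Sum>y\<in>V. v y * ((u y - u x) * weight x y))"
    by (simp add: dirichlet_def sum.distrib[symmetric] algebra_simps)
  also have "(\<Sum>x\<in>V. \<Sum>y\<in>V. v y * ((u y - u x) * weight x y))
      = (\<Sum>x\<in>V. \<Sum>y\<in>V. v x * ((u x - u y) * weight x y))"
    by (subst sum.swap) (simp add: weight_commute)
  finally show ?thesis unfolding flow_def sum_distrib_left by linarith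
qed

lemma dirichlet_nonneg: "0 \<le> dirichlet u u"
  unfolding dirichlet_def by (auto intro!: sum_nonneg simp: weight_nonneg)

lemma dirichlet_add_scale:
  "dirichlet (\<lambda>z. u z + s * v z) (\<lambda>z. u z + s * v z)
     = dirichlet u u + 2 * s * dirichlet u v + s\<^sup>2 * dirichlet v v"
proof -
  have "dirichlet (\<lambda>z. u z + s * v z) (\<lambda>z. u z + s * v z)
      = (\<Sum>x\<in>V. \<Sum>y\<in>V. (u x - u y) * (u x - u y) * weight x y
          + (2 * s * ((u x - u y) * (v x - v y) * weight x y)
          + s\<^sup>2 * ((v x - v y) * (v x - v y) * weight x y))) / 2"
    unfolding dirichlet_def
    by (intro arg_cong2[where f = "(/)"] sum.cong refl) (simp add: algebra_simps power2_eq_square)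
  also have "\<dots> = dirichlet u u + 2 * s * dirichlet u v + s\<^sup>2 * dirichlet v v"
    unfolding dirichlet_def sum.distrib sum_distrib_left[symmetric] by (simp add: field_simps)
  finally show ?thesis .
qed

lemma dirichlet_scale: "dirichlet (\<lambda>z. c * u z) (\<lambda>z. c * u z) = c\<^sup>2 * dirichlet u u"
  using dirichlet_add_scale[of "\<lambda>_. 0" c u] by (simp add: dirichlet_def)

text \<open>Turns stationarity of the energy into an equation at a single vertex.\<close>

lemma dirichlet_indicator:
  assumes "x \<in> V" shows "dirichlet u (\<lambda>z. if z = x then 1 else 0) = flow u x"
  using assms finite_V by (simp add: dirichlet_eq_flow if_distrib[of "\<lambda>c. c * _"] cong: if_cong)

lemma dirichlet_add_const:
  "dirichlet (\<lambda>z. u z + c) v = dirichlet u v" "dirichlet u (\<lambda>z. v z + c) = dirichlet u v"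
  by (simp_all add: dirichlet_def)

section \<open>Harmonic extensions by minimising the energy over a box\<close>

lemma compact_box:
  "compact {u. u \<in> supported_funs V \<and> (\<forall>x. \<bar>u x\<bar> \<le> M)}"
proof -
  \<comment> \<open>Tychonoff: the box is a product of intervals over \<open>V\<close> and of
    \<open>{0}\<close> elsewhere.\<close>
  have "compactin (product_topology (\<lambda>_::'a. euclidean::real topology) UNIV)
      (PiE UNIV (\<lambda>x. if x \<in> V then {- M..M} else {0}))"
    by (subst compactin_PiE) auto
  hence "compact (PiE UNIV (\<lambda>x. if x \<in> V then {- M..M} else {0::real}))"
    by (simp add: euclidean_product_topology)
  moreover have "{u. u \<in> supported_funs V \<and> (\<forall>x. \<bar>u x\<bar> \<le> M)}
      = (if M < 0 then {} else PiE UNIV (\<lambda>x. if x \<in> V then {- M..M} else {0}))"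
  \<comment> \<open>A negative \<open>M\<close> is separate: the bound is imposed at every point of
    the type, so the box is empty, while the product is not if \<open>V\<close> is empty.\<close>
  proof (cases "M < 0")
    case True
    hence "\<not> \<bar>u x\<bar> \<le> M" for u :: "'a \<Rightarrow> real" and x by linarith
    thus ?thesis using True by simp
  next
    case False
    hence "u x \<in> (if x \<in> V then {- M..M} else {0}) \<longleftrightarrow> (x \<notin> V \<longrightarrow> u x = 0) \<and> \<bar>u x\<bar> \<le> M"
      for u :: "'a \<Rightarrow> real" and x by auto
    hence "u \<in> PiE UNIV (\<lambda>x. if x \<in> V then {- M..M} else {0})
        \<longleftrightarrow> u \<in> supported_funs V \<and> (\<forall>x. \<bar>u x\<bar> \<le> M)" for u :: "'a \<Rightarrow> real"
      unfolding PiE_UNIV_domain Pi_iff supported_funs_def by auto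
    thus ?thesis using False by auto
  qed
  ultimately show ?thesis by simp
qed

lemma continuous_dirichlet: "continuous_on A (\<lambda>u. dirichlet u u)"
  unfolding dirichlet_def
  by (intro continuous_intros continuous_on_subset[OF continuous_on_product_coordinates]) auto

text \<open>Replacing \<open>u x\<close> at an interior vertex by the weighted mean of its neighbours keeps \<open>u\<close> in
  the box and lowers the energy by \<open>(flow u x)\<^sup>2\<close> over the weighted degree.\<close>

lemma obtain_harmonic_minimizer:
  assumes "closed K" "u0 \<in> K" "u0 \<in> supported_funs V" "\<And>x. \<bar>u0 x\<bar> \<le> M"
    and upd: "\<And>u x t. u \<in> K \<Longrightarrow> x \<in> V - B \<Longrightarrow> u(x := t) \<in> K"
  obtains u where "u \<in> K" "u \<in> supported_funs V" "\<And>x. \<bar>u x\<bar> \<le> M"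
    "\<And>x. x \<in> V - B \<Longrightarrow> flow u x = 0"
    "\<And>v. v \<in> K \<Longrightarrow> v \<in> supported_funs V \<Longrightarrow> (\<And>x. \<bar>v x\<bar> \<le> M) \<Longrightarrow> dirichlet u u \<le> dirichlet v v"
proof -
  let ?C = "{u. u \<in> supported_funs V \<and> (\<forall>x. \<bar>u x\<bar> \<le> M)} \<inter> K"
  have "compact ?C" using compact_box assms(1) by (rule compact_Int_closed)
  moreover have "?C \<noteq> {}" using assms by auto
  ultimately obtain u where u: "u \<in> ?C" "\<And>v. v \<in> ?C \<Longrightarrow> dirichlet u u \<le> dirichlet v v"
    using continuous_attains_inf[of ?C "\<lambda>u. dirichlet u u"] continuous_dirichlet by blast
  have "flow u x = 0" if x: "x \<in> V - B" for x
  proof -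
    define d where "d = (\<Sum>y\<in>V. weight x y)"
    have d0: "d \<ge> 0" by (simp add: d_def sum_nonneg weight_nonneg)
    show ?thesis
    proof (cases "d = 0")
      case True
      hence "\<forall>y\<in>V. weight x y = 0"
        using finite_V by (simp add: d_def sum_nonneg_eq_0_iff weight_nonneg)
      thus ?thesis by (simp add: flow_def)
    next
      case False
      hence d: "d > 0" using d0 by simp
      define e :: "'a \<Rightarrow> real" where "e = (\<lambda>z. if z = x then 1 else 0)"
      \<comment> \<open>The minimiser of \<open>2 * s * flow u x + s^2 * d\<close>, the energy
        change along \<open>e\<close>.\<close>
      define s where "s = - flow u x / d"
      have ee: "dirichlet e e = d"
      proof -
        have "dirichlet e e = flow e x" using x by (simp add: e_def dirichlet_indicator)
        also have "\<dots> = d" unfolding flow_def d_def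
          by (intro sum.cong) (auto simp: e_def weight_self)
        finally show ?thesis .
      qed
      let ?v = "\<lambda>z. u z + s * e z"
      have v: "?v = u(x := u x + s)" by (auto simp: e_def)
      have "d * (u x + s) = (\<Sum>y\<in>V. u y * weight x y)"
        using d by (simp add: s_def d_def flow_def field_simps sum_subtractf sum_distrib_left)
      hence "\<bar>d * (u x + s)\<bar> \<le> (\<Sum>y\<in>V. \<bar>u y * weight x y\<bar>)" by (simp add: sum_abs)
      also have "\<dots> \<le> (\<Sum>y\<in>V. M * weight x y)"
        using u by (intro sum_mono) (auto simp: abs_mult weight_nonneg intro!: mult_right_mono)
      also have "\<dots> = d * M" by (simp add: d_def sum_distrib_left mult.commute)
      finally have "\<bar>u x + s\<bar> \<le> M" using d by (simp add: abs_mult)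
      hence "u(x := u x + s) \<in> ?C" using u x upd by (auto simp: supported_funs_def)
      hence "dirichlet u u \<le> dirichlet ?v ?v" unfolding v by (rule u(2))
      also have "\<dots> = dirichlet u u + 2 * s * flow u x + s\<^sup>2 * d"
        using x by (subst dirichlet_add_scale) (simp add: ee, simp add: e_def dirichlet_indicator)
      also have "\<dots> = dirichlet u u - (flow u x)\<^sup>2 / d"
        using d by (simp add: s_def power2_eq_square field_simps)
      finally have "(flow u x)\<^sup>2 / d \<le> 0" by simp
      thus ?thesis using d by (simp add: divide_le_0_iff)
    qed
  qed
  thus ?thesis using u that by blast
qed

text \<open>Minimise the energy among functions with the given boundary values, with
  \<open>f\<close> itself as a competitor. The bound \<open>M\<close> is carried along so that the
  extension can later compete with a minimiser over the same box.\<close>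

lemma obtain_harmonic_extension:
  assumes "f \<in> supported_funs B" "\<And>x. \<bar>f x\<bar> \<le> M"
  obtains u where "u \<in> supported_funs V" "\<And>x. x \<in> B \<Longrightarrow> u x = f x" "\<And>x. \<bar>u x\<bar> \<le> M"
    "\<And>x. x \<in> V - B \<Longrightarrow> flow u x = 0"
proof -
  have "closed (\<Inter>x\<in>B. {u. u x = f x})"
    by (intro closed_INT ballI closed_Collect_eq continuous_on_product_coordinates continuous_on_const)
  moreover have "(\<Inter>x\<in>B. {u. u x = f x}) = {u. \<forall>x\<in>B. u x = f x}" by auto
  ultimately have "closed {u. \<forall>x\<in>B. u x = f x}" by simp
  moreover have "f \<in> supported_funs V" using assms B_subset by (auto simp: supported_funs_def)
  ultimately show ?thesis
    using assms(2) that by (elim obtain_harmonic_minimizer[where M = M and ?u0.0 = f]) auto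
qed

text \<open>Dirichlet's principle: \<open>v - u\<close> vanishes on \<open>B\<close> and the flow of
  \<open>u\<close> vanishes off \<open>B\<close>, so the cross term in the energy of
  \<open>u + (v - u)\<close> is 0.\<close>

lemma dirichlet_le_of_harmonic:
  assumes "\<And>x. x \<in> B \<Longrightarrow> u x = v x" "\<And>x. x \<in> V - B \<Longrightarrow> flow u x = 0"
  shows "dirichlet u u \<le> dirichlet v v"
proof -
  have "dirichlet u (\<lambda>z. v z - u z) = 0"
    unfolding dirichlet_eq_flow using assms by (intro sum.neutral) force
  thus ?thesis
    using dirichlet_add_scale[of u 1 "\<lambda>z. v z - u z"] dirichlet_nonneg[of "\<lambda>z. v z - u z"] by simp
qed

section \<open>Energy along a path\<close>

lemma path_energy_bound:
  assumes p: "path_between x y p" and c: "\<And>e. e \<in> E \<Longrightarrow> c \<le> w e"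
  shows "c * (u x - u y)\<^sup>2 \<le> real (length p - 1) * dirichlet u u"
proof (cases "c \<ge> 0")
  case False
  hence "c * (u x - u y)\<^sup>2 \<le> 0" by (simp add: mult_nonpos_nonneg)
  also have "0 \<le> real (length p - 1) * dirichlet u u" by (simp add: dirichlet_nonneg)
  finally show ?thesis .
next
  case True
  define n where "n = length p - 1"
  have ne: "p \<noteq> []" and d: "distinct p" and xy: "hd p = x" "last p = y"
    using p by (auto simp: path_between_def)
  have len: "length p = Suc n" using ne by (simp add: n_def)
  have edge: "{p ! i, p ! Suc i} \<in> E" if "i < n" for i
    using p that len by (auto simp: path_between_def successively_conv_nth)
  define F where "F = (\<lambda>(a, b). (u a - u b) * (u a - u b) * weight a b)"
  \<comment> \<open>\<open>g\<close> and \<open>h\<close> list the path edges in both orientations,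
    to match the double sum in \<open>dirichlet\<close>. Distinctness of the vertices keeps these
    ordered pairs all different.\<close>
  define g where "g = (\<lambda>i. (p ! i, p ! Suc i))"
  define h where "h = (\<lambda>i. (p ! Suc i, p ! i))"
  have inj: "inj_on g {..<n}" "inj_on h {..<n}"
    using d len by (auto simp: inj_on_def g_def h_def nth_eq_iff_index_eq)
  have disj: "g ` {..<n} \<inter> h ` {..<n} = {}"
    using d len by (auto simp: g_def h_def nth_eq_iff_index_eq)
  have F: "F (g i) \<ge> c * (u (p ! Suc i) - u (p ! i))\<^sup>2" "F (h i) = F (g i)" if "i < n" for i
  proof -
    have "c \<le> weight (p ! i) (p ! Suc i)" using c edge[OF that] by (simp add: weight_def)
    thus "F (g i) \<ge> c * (u (p ! Suc i) - u (p ! i))\<^sup>2"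
      by (simp add: F_def g_def power2_eq_square mult.commute[of c] square_diff_square_factored
          mult_right_mono mult_left_mono minus_mult_minus)
        (metis (no_types) minus_diff_eq minus_mult_minus mult_left_mono zero_le_square)
    show "F (h i) = F (g i)"
      by (simp add: F_def g_def h_def weight_commute algebra_simps)
  qed
  have "(u x - u y)\<^sup>2 = (\<Sum>i<n. u (p ! Suc i) - u (p ! i))\<^sup>2"
    using ne xy len by (subst sum_lessThan_telescope)
      (simp add: hd_conv_nth last_conv_nth power2_commute)
  also have "\<dots> \<le> (\<Sum>i<n. (u (p ! Suc i) - u (p ! i))\<^sup>2) * card {..<n}"
    by (rule sum_squared_le_sum_of_squares)
  finally have "c * (u x - u y)\<^sup>2 \<le> c * ((\<Sum>i<n. (u (p ! Suc i) - u (p ! i))\<^sup>2) * n)"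
    using True by (simp add: mult_left_mono)
  also have "\<dots> = n * (\<Sum>i<n. c * (u (p ! Suc i) - u (p ! i))\<^sup>2)"
    by (simp add: sum_distrib_left algebra_simps)
  also have "\<dots> \<le> n * (\<Sum>i<n. F (g i))"
    using F by (intro mult_left_mono sum_mono) auto
  also have "(\<Sum>i<n. F (g i)) \<le> dirichlet u u"
  proof -
    have "2 * (\<Sum>i<n. F (g i)) = (\<Sum>i<n. F (g i)) + (\<Sum>i<n. F (h i))" using F by simp
    also have "\<dots> = sum F (g ` {..<n} \<union> h ` {..<n})"
      using inj disj by (simp add: sum.union_disjoint sum.reindex)
    also have "\<dots> \<le> sum F (V \<times> V)"
      using finite_V edge edge_vertices
      by (intro sum_mono2) (auto simp: g_def h_def F_def weight_nonneg)
    also have "\<dots> = 2 * dirichlet u u"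
      by (simp add: dirichlet_def F_def sum.cartesian_product)
    finally show ?thesis by simp
  qed
  hence "n * (\<Sum>i<n. F (g i)) \<le> n * dirichlet u u" by (simp add: mult_left_mono)
  finally show ?thesis by (simp add: n_def)
qed

section \<open>Steklov eigenpairs\<close>

text \<open>The eigenvalue equation stated for the extended function on \<open>V\<close>, which
  avoids the definite description in \<open>harmonic_extension\<close>.\<close>

definition steklov_pair :: "real \<Rightarrow> ('a \<Rightarrow> real) \<Rightarrow> bool" where
  "steklov_pair \<mu> u \<longleftrightarrow> (\<forall>x\<in>V. flow u x = (if x \<in> B then \<mu> * m x * u x else 0))"

text \<open>The weak form of the eigenvalue equation, from Green's formula. Testing it with 1, with
  \<open>u\<close> and with another eigenfunction gives mean zero, nonnegativity and
  orthogonality.\<close>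

lemma dirichlet_steklov_pair:
  assumes "steklov_pair \<mu> u"
  shows "dirichlet u v = \<mu> * (\<Sum>x\<in>B. m x * u x * v x)"
proof -
  have "dirichlet u v = (\<Sum>x\<in>V. if x \<in> B then \<mu> * (m x * u x * v x) else 0)"
    unfolding dirichlet_eq_flow using assms by (intro sum.cong) (auto simp: steklov_pair_def)
  also have "\<dots> = (\<Sum>x\<in>B. \<mu> * (m x * u x * v x))"
    using finite_V B_subset by (simp add: sum.inter_restrict[symmetric] Int_absorb1)
  finally show ?thesis by (simp add: sum_distrib_left)
qed

lemma steklov_pair_mean_zero:
  assumes "steklov_pair \<mu> u" "\<mu> \<noteq> 0"
  shows "(\<Sum>x\<in>B. m x * u x) = 0"
  using dirichlet_steklov_pair[OF assms(1), of "\<lambda>_. 1"] assms(2) by (simp add: dirichlet_def)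

lemma boundary_norm_pos:
  assumes "x \<in> B" "u x \<noteq> 0" shows "0 < (\<Sum>x\<in>B. m x * (u x)\<^sup>2)"
  using assms m_pos_B finite_B by (intro sum_pos2[of B x]) (auto simp: less_imp_le)

lemma steklov_pair_nonneg:
  assumes "steklov_pair \<mu> u" "x \<in> B" "u x \<noteq> 0"
  shows "0 \<le> \<mu>"
proof -
  have "0 \<le> \<mu> * (\<Sum>x\<in>B. m x * (u x)\<^sup>2)"
    using dirichlet_steklov_pair[OF assms(1), of u] dirichlet_nonneg[of u]
    by (simp add: power2_eq_square mult.assoc)
  thus ?thesis using boundary_norm_pos[of x u] assms(2,3) by (simp add: zero_le_mult_iff)
qed

lemma steklov_pair_orthogonal:
  assumes "steklov_pair \<mu> u" "steklov_pair \<nu> v" "\<mu> \<noteq> \<nu>"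
  shows "(\<Sum>x\<in>B. m x * u x * v x) = 0"
proof -
  have "\<mu> * (\<Sum>x\<in>B. m x * u x * v x) = \<nu> * (\<Sum>x\<in>B. m x * v x * u x)"
    using dirichlet_steklov_pair[OF assms(1), of v] dirichlet_steklov_pair[OF assms(2), of u]
      dirichlet_commute[of u v] by simp
  thus ?thesis using assms(3) by (simp add: mult.assoc mult.commute[of "u _"])
qed

end

section \<open>Consequences of connectedness for extensions and eigenspaces\<close>

context finite_connected_boundary_graph
begin

lemma dirichlet_eq_0_imp_const:
  assumes "dirichlet u u = 0" "x \<in> V" "y \<in> V"
  shows "u x = u y"
proof -
  \<comment> \<open>Inserting 1 keeps the minimum meaningful and positive when there are no
    edges.\<close>
  define c where "c = Min (insert 1 (w ` E))"
  have c: "c > 0" "\<And>e. e \<in> E \<Longrightarrow> c \<le> w e"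
    using finite_E w_pos by (auto simp: c_def Min_gr_iff)
  obtain p where "path_between x y p" using connected assms by blast
  from path_energy_bound[OF this c(2), of u] have "c * (u x - u y)\<^sup>2 \<le> 0" by (simp add: assms)
  thus ?thesis using c by (simp add: mult_le_0_iff)
qed

text \<open>By Green's formula the difference has zero energy, hence is constant on
  \<open>V\<close>; a boundary vertex shows that the constant is 0.\<close>

lemma harmonic_extension_unique:
  assumes "B \<noteq> {}" "u \<in> supported_funs V" "v \<in> supported_funs V" "\<And>x. x \<in> B \<Longrightarrow> u x = v x"
    "\<And>x. x \<in> V - B \<Longrightarrow> flow u x = 0" "\<And>x. x \<in> V - B \<Longrightarrow> flow v x = 0"
  shows "u = v"
proof -
  define h where "h = (\<lambda>z. u z - v z)"
  have fl: "flow h x = flow u x - flow v x" for x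
    by (simp add: h_def flow_def algebra_simps flip: sum_subtractf)
  have "dirichlet h h = 0"
    unfolding dirichlet_eq_flow fl using assms by (intro sum.neutral) (force simp: h_def)
  obtain b where b: "b \<in> B" using assms by blast
  have "h x = 0" for x
  proof (cases "x \<in> V")
    case True
    hence "h x = h b" using b B_subset \<open>dirichlet h h = 0\<close> by (intro dirichlet_eq_0_imp_const) auto
    thus ?thesis using assms b by (simp add: h_def)
  qed (use assms in \<open>auto simp: h_def supported_funs_def\<close>)
  thus ?thesis by (simp add: h_def fun_eq_iff)
qed

lemma laplacian_eq_0_iff: "x \<in> V \<Longrightarrow> laplacian u x = 0 \<longleftrightarrow> flow u x = 0"
proof -
  assume x: "x \<in> V"
  have "(\<Sum>y\<in>V. (u y - u x) * weight x y) = - flow u x"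
    by (simp add: flow_def algebra_simps flip: sum_negf)
  thus ?thesis using m_pos[OF x] by (simp add: laplacian_def)
qed

lemma harmonic_extension_eqI:
  assumes "B \<noteq> {}" "u \<in> supported_funs V" "\<And>x. x \<in> B \<Longrightarrow> u x = f x" "\<And>x. x \<in> V - B \<Longrightarrow> flow u x = 0"
  shows "harmonic_extension f = u"
  unfolding harmonic_extension_def
  using assms by (intro the_equality conjI ballI harmonic_extension_unique) (auto simp: laplacian_eq_0_iff)

text \<open>Restriction to \<open>B\<close> carries eigenpairs on \<open>V\<close> to eigenfunctions
  of the operator, and harmonic extension goes back.\<close>

lemma steklov_eigenspace_eq:
  assumes "B \<noteq> {}"
  shows "steklov_eigenspace \<mu> =
    (\<lambda>u x. if x \<in> B then u x else 0) ` {u \<in> supported_funs V. steklov_pair \<mu> u}"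
proof (intro equalityI subsetI)
  fix f assume f: "f \<in> steklov_eigenspace \<mu>"
  hence fs: "f \<in> supported_funs B" and op: "steklov_op f = (\<lambda>x. \<mu> * f x)"
    by (auto simp: steklov_eigenspace_def)
  \<comment> \<open>Any bound on \<open>f\<close> would do; one is required to choose the
    box.\<close>
  have "\<bar>f x\<bar> \<le> (\<Sum>b\<in>B. \<bar>f b\<bar>)" for x
    using fs finite_B by (cases "x \<in> B") (auto simp: supported_funs_def intro: member_le_sum sum_nonneg)
  with fs obtain u where u: "u \<in> supported_funs V" "\<And>x. x \<in> B \<Longrightarrow> u x = f x"
    "\<And>x. x \<in> V - B \<Longrightarrow> flow u x = 0"
    by (rule obtain_harmonic_extension) auto
  have "harmonic_extension f = u" using assms u by (rule harmonic_extension_eqI)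
  hence "flow u x = \<mu> * m x * u x" if "x \<in> B" for x
    using fun_cong[OF op, of x] that u m_pos_B[OF that]
    by (simp add: steklov_op_def normal_derivative_def flow_def field_simps)
  hence "steklov_pair \<mu> u" using u by (auto simp: steklov_pair_def)
  moreover have "f = (\<lambda>x. if x \<in> B then u x else 0)"
    using fs u by (auto simp: supported_funs_def)
  ultimately show "f \<in> (\<lambda>u x. if x \<in> B then u x else 0) ` {u \<in> supported_funs V. steklov_pair \<mu> u}"
    using u by blast
next
  fix f assume "f \<in> (\<lambda>u x. if x \<in> B then u x else 0) ` {u \<in> supported_funs V. steklov_pair \<mu> u}"
  then obtain u where u: "u \<in> supported_funs V" "steklov_pair \<mu> u"
    and f: "f = (\<lambda>x. if x \<in> B then u x else 0)" by blast
  have "harmonic_extension f = u"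
    using assms u by (intro harmonic_extension_eqI) (auto simp: f steklov_pair_def)
  moreover have "normal_derivative u x = \<mu> * u x" if "x \<in> B" for x
  proof -
    have "flow u x = \<mu> * m x * u x" using that u B_subset by (auto simp: steklov_pair_def)
    thus ?thesis using m_pos_B[OF that] by (simp add: normal_derivative_def flow_def)
  qed
  ultimately show "f \<in> steklov_eigenspace \<mu>"
    by (auto simp: steklov_eigenspace_def supported_funs_def f steklov_op_def)
qed

section \<open>The set of eigenvalues and the multiplicity of 0\<close>

lemma steklov_eigenvalue_iff:
  assumes "B \<noteq> {}"
  shows "steklov_eigenvalue \<mu> \<longleftrightarrow> (\<exists>u\<in>supported_funs V. steklov_pair \<mu> u \<and> (\<exists>x\<in>B. u x \<noteq> 0))"
  unfolding steklov_eigenvalue_def steklov_eigenspace_eq[OF assms] by (auto simp: fun_eq_iff)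

text \<open>Eigenfunctions of different eigenvalues are orthogonal, hence independent in a
  finite-dimensional space. Without finiteness \<open>sorted_list_of_set\<close> would return the
  empty list.\<close>

lemma finite_steklov_eigenvalues:
  assumes "B \<noteq> {}"
  shows "finite {\<mu>. steklov_eigenvalue \<mu>}"
proof -
  let ?S = "{\<mu>. steklov_eigenvalue \<mu>}"
  have "\<forall>\<mu>\<in>?S. \<exists>f. f \<in> steklov_eigenspace \<mu> \<and> f \<noteq> 0" by (auto simp: steklov_eigenvalue_def)
  then obtain F where F: "\<And>\<mu>. \<mu> \<in> ?S \<Longrightarrow> F \<mu> \<in> steklov_eigenspace \<mu>" "\<And>\<mu>. \<mu> \<in> ?S \<Longrightarrow> F \<mu> \<noteq> 0"
    by metis
  have "inj_on F ?S"
  proof (rule inj_onI)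
    fix \<mu> \<nu> assume *: "\<mu> \<in> ?S" "\<nu> \<in> ?S" "F \<mu> = F \<nu>"
    hence "(\<lambda>x. \<mu> * F \<mu> x) = (\<lambda>x. \<nu> * F \<mu> x)"
      using F(1)[of \<mu>] F(1)[of \<nu>] by (simp add: steklov_eigenspace_def)
    thus "\<mu> = \<nu>" using F(2)[OF *(1)] by (auto simp: fun_eq_iff)
  qed
  moreover have "finite (F ` ?S)"
  proof (rule finite_independent_supported_funs[OF finite_B])
    show sub: "F ` ?S \<subseteq> supported_funs B" using F by (auto simp: steklov_eigenspace_def)
    show "fun_real.independent (F ` ?S)"
    proof (rule independent_if_orthogonal[OF sub _ finite_B, of m])
      show "0 \<notin> F ` ?S" using F by auto
      show "m x > 0" if "x \<in> B" for x using that by (rule m_pos_B)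
      fix f g assume "f \<in> F ` ?S" "g \<in> F ` ?S" "f \<noteq> g"
      then obtain \<mu> \<nu> where mn: "\<mu> \<in> ?S" "\<nu> \<in> ?S" "f = F \<mu>" "g = F \<nu>" "\<mu> \<noteq> \<nu>" by auto
      obtain u where u: "steklov_pair \<mu> u" "f = (\<lambda>x. if x \<in> B then u x else 0)"
        using F(1)[OF mn(1)] mn(3) unfolding steklov_eigenspace_eq[OF assms] by auto
      obtain v where v: "steklov_pair \<nu> v" "g = (\<lambda>x. if x \<in> B then v x else 0)"
        using F(1)[OF mn(2)] mn(4) unfolding steklov_eigenspace_eq[OF assms] by auto
      show "(\<Sum>x\<in>B. m x * f x * g x) = 0"
        using steklov_pair_orthogonal[OF u(1) v(1) mn(5)] by (simp add: u(2) v(2))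
    qed
  qed
  ultimately show ?thesis by (rule finite_imageD[rotated])
qed

text \<open>An eigenfunction for 0 has zero energy and so is constant. Hence 0 fills exactly one
  place of the spectrum.\<close>

lemma fun_dim_steklov_eigenspace_0:
  assumes "B \<noteq> {}"
  shows "fun_dim (steklov_eigenspace 0) = 1"
proof -
  define e :: "'a \<Rightarrow> real" where "e = (\<lambda>x. if x \<in> B then 1 else 0)"
  have e0: "e \<noteq> 0" using assms by (auto simp: e_def fun_eq_iff)
  have "(\<lambda>x. if x \<in> V then 1 else 0) \<in> {u \<in> supported_funs V. steklov_pair 0 u}"
    by (auto simp: supported_funs_def steklov_pair_def flow_def)
  hence "(\<lambda>x. if x \<in> B then (if x \<in> V then 1 else 0) else 0) \<in> steklov_eigenspace 0"
    unfolding steklov_eigenspace_eq[OF assms] by (rule rev_image_eqI) simp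
  also have "(\<lambda>x. if x \<in> B then (if x \<in> V then 1 else 0) else 0) = e"
    using B_subset by (auto simp: e_def fun_eq_iff)
  finally have "e \<in> steklov_eigenspace 0" .
  moreover have "steklov_eigenspace 0 \<subseteq> fun_real.span {e}"
  proof
    fix f assume "f \<in> steklov_eigenspace 0"
    then obtain u where u: "steklov_pair 0 u" "f = (\<lambda>x. if x \<in> B then u x else 0)"
      unfolding steklov_eigenspace_eq[OF assms] by blast
    have "dirichlet u u = 0" using dirichlet_steklov_pair[OF u(1)] by simp
    obtain b where "b \<in> B" using assms by blast
    have "u x = u b" if "x \<in> B" for x
      using that \<open>b \<in> B\<close> B_subset by (intro dirichlet_eq_0_imp_const[OF \<open>dirichlet u u = 0\<close>]) auto
    hence "f = (\<lambda>x. u b * e x)" by (simp add: u(2) e_def fun_eq_iff)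
    moreover have "e \<in> fun_real.span {e}" by (rule fun_real.span_base) (rule singletonI)
    hence "(\<lambda>x. u b * e x) \<in> fun_real.span {e}" by (rule fun_real.span_scale)
    ultimately show "f \<in> fun_real.span {e}" by (simp only:)
  qed
  moreover have "fun_real.independent {e}"
    using e0 by (simp only: fun_real.dependent_single not_False_eq_True)
  ultimately have "card {e} = fun_dim (steklov_eigenspace 0)"
    by (intro fun_real.basis_card_eq_dim) auto
  thus ?thesis by simp
qed

section \<open>A positive eigenvalue from the Rayleigh quotient\<close>

lemma exists_positive_steklov_pair:
  assumes "a \<in> B" "b \<in> B" "a \<noteq> b"
  obtains \<mu> u where "\<mu> > 0" "u \<in> supported_funs V" "steklov_pair \<mu> u" "\<exists>x\<in>B. u x \<noteq> 0"
proof -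
  define mean :: "('a \<Rightarrow> real) \<Rightarrow> real" where "mean u = (\<Sum>x\<in>B. m x * u x)" for u
  define nrm :: "('a \<Rightarrow> real) \<Rightarrow> real" where "nrm u = (\<Sum>x\<in>B. m x * (u x)\<^sup>2)" for u
  define K where "K = {u. mean u = 0} \<inter> {u. nrm u = 1}"
  \<comment> \<open>Unit norm gives \<open>(u x)^2 \<le> 1 / m x\<close> on \<open>B\<close>. The
    summand 1 yields \<open>M \<le> M^2\<close>, so \<open>M\<close> bounds the boundary values of
    all members of \<open>K\<close>.\<close>
  define M where "M = 1 + (\<Sum>x\<in>B. 1 / m x)"
  have "0 \<le> (\<Sum>x\<in>B. 1 / m x)" using m_pos_B by (intro sum_nonneg) (simp add: less_imp_le)
  hence M1: "M \<ge> 1" by (simp add: M_def)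
  have K_bound: "\<bar>u x\<bar> \<le> M" if "u \<in> K" "x \<in> B" for u x
  proof -
    have "m x * (u x)\<^sup>2 \<le> nrm u" unfolding nrm_def
      using that finite_B m_pos_B by (intro member_le_sum) (auto simp: less_imp_le)
    hence "(u x)\<^sup>2 \<le> 1 / m x" using that m_pos_B[of x] by (simp add: K_def field_simps)
    also have "\<dots> \<le> (\<Sum>x\<in>B. 1 / m x)"
      using that finite_B m_pos_B by (intro member_le_sum) (auto simp: less_imp_le)
    also have "\<dots> \<le> M" by (simp add: M_def)
    also have "M \<le> M\<^sup>2" using M1 by (simp add: power2_eq_square)
    finally show ?thesis using M1 by (simp add: power2_le_iff_abs_le)
  qed
  have nrm_scale: "nrm (\<lambda>x. c * u x) = c\<^sup>2 * nrm u" for c u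
    by (simp add: nrm_def sum_distrib_left power_mult_distrib algebra_simps)
  have mean_scale: "mean (\<lambda>x. c * u x) = c * mean u" for c u
    by (simp add: mean_def sum_distrib_left algebra_simps)
  have normalise: "(\<lambda>x. (1 / sqrt (nrm u)) * u x) \<in> K" if "mean u = 0" "nrm u > 0" for u
    unfolding K_def using that mean_scale[of "1 / sqrt (nrm u)" u] nrm_scale[of "1 / sqrt (nrm u)" u]
    by (simp add: power_divide)
  \<comment> \<open>The reciprocal masses at \<open>a\<close> and \<open>b\<close> cancel in the
    weighted mean, so after normalisation \<open>K\<close> is seen to be nonempty.\<close>
  define h where "h = (\<lambda>x. if x = a then 1 / m a else if x = b then - 1 / m b else 0)"
  define u0 where "u0 = (\<lambda>x. (1 / sqrt (nrm h)) * h x)"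
  have pos: "m a > 0" "m b > 0" using assms m_pos_B by auto
  have "mean h = (\<Sum>x\<in>{a, b}. m x * h x)"
    unfolding mean_def using finite_B assms by (intro sum.mono_neutral_right) (auto simp: h_def)
  also have "\<dots> = 0" using pos assms by (simp add: h_def)
  finally have "mean h = 0" .
  moreover have "nrm h > 0" unfolding nrm_def
    using pos assms by (intro boundary_norm_pos[of a]) (auto simp: h_def)
  ultimately have "u0 \<in> K" unfolding u0_def by (rule normalise)
  have u0: "u0 \<in> supported_funs V" using assms B_subset by (auto simp: u0_def h_def supported_funs_def)
  have u0_bound: "\<bar>u0 x\<bar> \<le> M" for x
  proof (cases "x \<in> B")
    case False
    hence "u0 x = 0" using assms by (auto simp: u0_def h_def)
    thus ?thesis using M1 by simp
  qed (use K_bound \<open>u0 \<in> K\<close> in auto)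
  have "closed K" unfolding K_def mean_def nrm_def
    by (intro closed_Int closed_Collect_eq continuous_intros
        continuous_on_subset[OF continuous_on_product_coordinates]) auto
  \<comment> \<open>Both constraints in \<open>K\<close> read boundary values only.\<close>
  moreover have "u(x := t) \<in> K" if "u \<in> K" "x \<in> V - B" for u x t
  proof -
    have "(\<Sum>z\<in>B. m z * (u(x := t)) z) = mean u" "(\<Sum>z\<in>B. m z * ((u(x := t)) z)\<^sup>2) = nrm u"
      unfolding mean_def nrm_def using that by (auto intro!: sum.cong)
    thus ?thesis using that(1) by (simp add: K_def mean_def nrm_def)
  qed
  ultimately obtain u where u: "u \<in> K" "u \<in> supported_funs V" "\<And>x. x \<in> V - B \<Longrightarrow> flow u x = 0"
    "\<And>v. v \<in> K \<Longrightarrow> v \<in> supported_funs V \<Longrightarrow> (\<And>x. \<bar>v x\<bar> \<le> M) \<Longrightarrow> dirichlet u u \<le> dirichlet v v"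
    using obtain_harmonic_minimizer[of K u0 M] \<open>u0 \<in> K\<close> u0 u0_bound by metis
  have u_mean: "mean u = 0" and u_nrm: "nrm u = 1" using u(1) by (auto simp: K_def)
  define \<mu> where "\<mu> = dirichlet u u"
  \<comment> \<open>Extends minimality from \<open>K\<close> within the box to all mean-zero
    functions, by scaling.\<close>
  have rayleigh: "\<mu> * nrm g \<le> dirichlet g g" if g: "mean g = 0" for g
  proof (cases "nrm g > 0")
    case False
    hence "\<mu> * nrm g \<le> 0" by (simp add: \<mu>_def dirichlet_nonneg mult_nonneg_nonpos)
    also have "0 \<le> dirichlet g g" by (rule dirichlet_nonneg)
    finally show ?thesis .
  next
    case True
    define c where "c = 1 / sqrt (nrm g)"
    \<comment> \<open>Values of \<open>g\<close> off \<open>B\<close> may leave the box, so they are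
      replaced by the harmonic extension, which stays inside and does not raise the energy.\<close>
    define f where "f = (\<lambda>x. if x \<in> B then c * g x else 0)"
    have cg: "(\<lambda>x. c * g x) \<in> K" unfolding c_def using g True by (rule normalise)
    have "f \<in> supported_funs B" by (simp add: f_def supported_funs_def)
    moreover have "\<bar>f x\<bar> \<le> M" for x using K_bound[OF cg, of x] M1 by (auto simp: f_def)
    ultimately obtain v where v: "v \<in> supported_funs V" "\<And>x. x \<in> B \<Longrightarrow> v x = f x" "\<And>x. \<bar>v x\<bar> \<le> M"
      "\<And>x. x \<in> V - B \<Longrightarrow> flow v x = 0"
      using obtain_harmonic_extension[of f M] by auto
    have vg: "v x = c * g x" if "x \<in> B" for x using v that by (simp add: f_def)
    have "v \<in> K" using cg vg by (simp add: K_def mean_def nrm_def)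
    hence "\<mu> \<le> dirichlet v v" unfolding \<mu>_def using v by (intro u) auto
    also have "\<dots> \<le> dirichlet (\<lambda>x. c * g x) (\<lambda>x. c * g x)"
      using vg v by (intro dirichlet_le_of_harmonic) auto
    also have "\<dots> = c\<^sup>2 * dirichlet g g" by (rule dirichlet_scale)
    also have "\<dots> = dirichlet g g / nrm g" using True by (simp add: c_def power_divide)
    finally show ?thesis using True by (simp add: field_simps)
  qed
  have "flow u y = \<mu> * m y * u y" if y: "y \<in> B" for y
  proof -
    \<comment> \<open>The weighted mean over \<open>B\<close> of the indicator of \<open>y\<close>;
      subtracting it gives an admissible direction \<open>e\<close> without changing
      energies.\<close>
    define k where "k = m y / (\<Sum>x\<in>B. m x)"
    define e where "e = (\<lambda>z. (if z = y then 1 else 0) + - k)"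
    have mB: "(\<Sum>x\<in>B. m x) > 0" using y finite_B m_pos_B by (intro sum_pos) auto
    have "mean e = (\<Sum>x\<in>B. (if x = y then m x else 0) - m x * k)"
      unfolding mean_def by (intro sum.cong) (auto simp: e_def algebra_simps)
    also have "\<dots> = m y - (\<Sum>x\<in>B. m x) * k"
      using y finite_B by (simp add: sum_subtractf sum_distrib_right)
    also have "\<dots> = 0" using mB by (simp add: k_def)
    finally have e_mean: "mean e = 0" .
    have ue: "dirichlet u e = flow u y"
      unfolding e_def dirichlet_add_const using y B_subset by (intro dirichlet_indicator) auto
    have "(\<Sum>x\<in>B. m x * u x * e x) = (\<Sum>x\<in>B. (if x = y then m x * u x else 0) - k * (m x * u x))"
      by (intro sum.cong) (auto simp: e_def algebra_simps)
    also have "\<dots> = m y * u y - k * mean u"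
      using y finite_B by (simp add: sum_subtractf sum_distrib_left mean_def)
    finally have une: "(\<Sum>x\<in>B. m x * u x * e x) = m y * u y" by (simp add: u_mean)
    \<comment> \<open>This is \<open>rayleigh\<close> at \<open>u + s * e\<close>; the constant
      terms cancel since \<open>nrm u = 1\<close> and \<open>dirichlet u u = \<mu>\<close>.\<close>
    have "0 \<le> 2 * s * (flow u y - \<mu> * (m y * u y)) + s\<^sup>2 * (dirichlet e e - \<mu> * nrm e)" for s
    proof -
      have "mean (\<lambda>z. u z + s * e z) = mean u + s * mean e"
        by (simp add: mean_def sum.distrib sum_distrib_left algebra_simps)
      hence "\<mu> * nrm (\<lambda>z. u z + s * e z) \<le> dirichlet (\<lambda>z. u z + s * e z) (\<lambda>z. u z + s * e z)"
        using e_mean u_mean by (intro rayleigh) simp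
      moreover have "nrm (\<lambda>z. u z + s * e z)
          = (\<Sum>x\<in>B. m x * (u x)\<^sup>2 + (2 * s * (m x * u x * e x) + s\<^sup>2 * (m x * (e x)\<^sup>2)))"
        unfolding nrm_def by (intro sum.cong) (auto simp: algebra_simps power2_eq_square)
      hence "nrm (\<lambda>z. u z + s * e z) = 1 + 2 * s * (m y * u y) + s\<^sup>2 * nrm e"
        using u_nrm une by (simp add: sum.distrib sum_distrib_left[symmetric] nrm_def)
      ultimately show ?thesis by (simp add: dirichlet_add_scale ue \<mu>_def[symmetric] algebra_simps)
    qed
    from linear_coefficient_eq_0[OF this] show ?thesis by simp
  qed
  hence "steklov_pair \<mu> u" using u by (auto simp: steklov_pair_def)
  moreover have nz: "\<exists>x\<in>B. u x \<noteq> 0"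
  proof (rule ccontr)
    assume "\<not> (\<exists>x\<in>B. u x \<noteq> 0)"
    hence "nrm u = 0" by (simp add: nrm_def)
    thus False using u_nrm by simp
  qed
  moreover have "\<mu> \<noteq> 0"
  proof
    assume "\<mu> = 0"
    hence "u x = u a" if "x \<in> B" for x
      using dirichlet_eq_0_imp_const[of u] that assms B_subset by (auto simp: \<mu>_def)
    hence "(\<Sum>x\<in>B. m x) * u a = 0" "u a \<noteq> 0"
      using u_mean nz by (auto simp: mean_def sum_distrib_right)
    moreover have "(\<Sum>x\<in>B. m x) > 0" using assms finite_B m_pos_B by (intro sum_pos) auto
    ultimately show False by simp
  qed
  hence "\<mu> > 0" using dirichlet_nonneg[of u] by (simp add: \<mu>_def)
  ultimately show ?thesis using u(2) that by blast
qed

section \<open>The lower bound for any positive eigenvalue\<close>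

lemma steklov_pair_lower_bound:
  assumes pair: "steklov_pair \<mu> u" "\<mu> > 0" "x0 \<in> B" "u x0 \<noteq> 0"
  defines "V_B \<equiv> \<Sum>x\<in>B. m x" and "m_0 \<equiv> Min (m ` B)" and "w_0 \<equiv> Min (w ` E)"
    and "d_B \<equiv> Max {graph_dist x y | x y. x \<in> B \<and> y \<in> B}"
  shows "w_0 * V_B / ((V_B - m_0)\<^sup>2 * real d_B) \<le> \<mu>"
proof -
  have B0: "B \<noteq> {}" using pair by blast
  have mean: "(\<Sum>x\<in>B. m x * u x) = 0" using steklov_pair_mean_zero[OF pair(1)] pair(2) by simp
  define N where "N = (\<Sum>x\<in>B. m x * (u x)\<^sup>2)"
  have N: "N > 0" unfolding N_def using pair by (intro boundary_norm_pos)
  have D: "dirichlet u u = \<mu> * N"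
    using dirichlet_steklov_pair[OF pair(1), of u] by (simp add: N_def power2_eq_square mult.assoc)
  obtain x where x: "x \<in> B" "\<And>z. z \<in> B \<Longrightarrow> u z \<le> u x"
  proof -
    have "Max (u ` B) \<in> u ` B" using finite_B B0 by simp
    then obtain x where "x \<in> B" "u x = Max (u ` B)" by auto
    thus ?thesis using finite_B by (intro that[of x]) auto
  qed
  obtain y where y: "y \<in> B" "\<And>z. z \<in> B \<Longrightarrow> u y \<le> u z"
  proof -
    have "Min (u ` B) \<in> u ` B" using finite_B B0 by simp
    then obtain y where "y \<in> B" "u y = Min (u ` B)" by auto
    thus ?thesis using finite_B by (intro that[of y]) auto
  qed
  have var: "N \<le> V_B * (u x - u y)\<^sup>2 / 4" unfolding N_def V_B_def
    using finite_B m_pos_B mean x y by (intro weighted_variance_bound) (auto simp: less_imp_le)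
  have xy: "x \<noteq> y"
  proof
    assume "x = y"
    thus False using var N by simp
  qed
  have m0_le: "m_0 \<le> m z" if "z \<in> B" for z using that finite_B by (simp add: m_0_def)
  have m0_pos: "m_0 > 0" unfolding m_0_def using finite_B B0 m_pos_B by (subst Min_gr_iff) auto
  \<comment> \<open>The two extremal vertices are distinct and each has mass at least
    \<open>m_0\<close>, so \<open>m_0\<close> is at most half of \<open>V_B\<close>.\<close>
  have "m x + m y = (\<Sum>z\<in>{x, y}. m z)" using xy by simp
  also have "\<dots> \<le> V_B" unfolding V_B_def
    using finite_B x y m_pos_B by (intro sum_mono2) (auto simp: less_imp_le)
  finally have half: "V_B / 2 \<le> V_B - m_0" and VB: "V_B > 0"
    using m0_le[OF x(1)] m0_le[OF y(1)] m0_pos by auto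
  have "\<exists>n. \<exists>p. path_between x y p \<and> n = length p - 1" using connected x y B_subset by blast
  from LeastI_ex[OF this] obtain p where p: "path_between x y p" "graph_dist x y = length p - 1"
    by (auto simp: graph_dist_def)
  have "{graph_dist x y | x y. x \<in> B \<and> y \<in> B} = (\<lambda>(x, y). graph_dist x y) ` (B \<times> B)" by auto
  hence "finite {graph_dist x y | x y. x \<in> B \<and> y \<in> B}" using finite_B by simp
  moreover have "graph_dist x y \<in> {graph_dist x y | x y. x \<in> B \<and> y \<in> B}" using x(1) y(1) by blast
  ultimately have dB: "length p - 1 \<le> d_B" unfolding d_B_def p(2)[symmetric] by (rule Max_ge)
  have len: "length p - 1 > 0"
    using p(1) xy by (cases p) (auto simp: path_between_def split: if_splits)
  \<comment> \<open>An edge exists, so \<open>w_0\<close> is a genuine minimum.\<close>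
  hence "{p ! 0, p ! Suc 0} \<in> E"
    using p(1) unfolding path_between_def successively_conv_nth by simp
  hence w0_pos: "w_0 > 0" unfolding w_0_def using finite_E w_pos by (subst Min_gr_iff) auto
  have "w_0 * (u x - u y)\<^sup>2 \<le> real (length p - 1) * dirichlet u u"
    using finite_E by (intro path_energy_bound[OF p(1)]) (simp add: w_0_def)
  also have "\<dots> \<le> real d_B * dirichlet u u"
    using dB by (intro mult_right_mono) (auto simp: dirichlet_nonneg)
  finally have path: "w_0 * (u x - u y)\<^sup>2 \<le> real d_B * (\<mu> * N)" by (simp add: D)
  have "(w_0 * V_B) * N \<le> (w_0 * V_B) * (V_B * (u x - u y)\<^sup>2 / 4)"
    using var w0_pos VB by (intro mult_left_mono) auto
  also have "\<dots> = (V_B / 2)\<^sup>2 * (w_0 * (u x - u y)\<^sup>2)" by (simp add: power2_eq_square)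
  also have "\<dots> \<le> (V_B - m_0)\<^sup>2 * (real d_B * (\<mu> * N))"
    by (intro mult_mono[OF _ path] power_mono half) (use VB w0_pos in auto)
  finally have "(w_0 * V_B) * N \<le> (\<mu> * ((V_B - m_0)\<^sup>2 * real d_B)) * N" by (simp add: algebra_simps)
  hence "w_0 * V_B \<le> \<mu> * ((V_B - m_0)\<^sup>2 * real d_B)" using N by simp
  moreover have "(V_B - m_0)\<^sup>2 * real d_B > 0" using half VB dB len by simp
  ultimately show ?thesis by (simp add: divide_le_eq)
qed

section \<open>Identifying the second Steklov eigenvalue\<close>

text \<open>No eigenvalue is negative and 0 is simple, so the second entry of the spectrum is the
  least positive eigenvalue.\<close>

lemma steklov_sigma_2_eigenvalue:
  assumes "2 \<le> card B"
  obtains \<mu> u x where "steklov_sigma 2 = ereal \<mu>" "\<mu> > 0" "steklov_pair \<mu> u" "x \<in> B" "u x \<noteq> 0"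
proof -
  obtain a b where ab: "a \<in> B" "b \<in> B" "a \<noteq> b"
    using assms card_le_Suc0_iff_eq[OF finite_B] by fastforce
  hence B0: "B \<noteq> {}" by blast
  let ?S = "{\<mu>. steklov_eigenvalue \<mu>}"
  have fin: "finite ?S" using B0 by (rule finite_steklov_eigenvalues)
  have nonneg: "0 \<le> \<mu>" if "\<mu> \<in> ?S" for \<mu>
    using that steklov_pair_nonneg by (auto simp: steklov_eigenvalue_iff[OF B0])
  have "steklov_pair 0 (\<lambda>x. if x \<in> V then 1 else 0)" by (simp add: steklov_pair_def flow_def)
  moreover have "(\<lambda>x. if x \<in> V then 1 else 0) \<in> supported_funs V" by (simp add: supported_funs_def)
  moreover have "\<exists>x\<in>B. (if x \<in> V then 1 else 0) \<noteq> (0::real)" using B0 B_subset by auto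
  ultimately have "0 \<in> ?S" unfolding mem_Collect_eq steklov_eigenvalue_iff[OF B0] by blast
  hence min0: "Min ?S = 0" using fin nonneg by (intro Min_eqI) auto
  let ?S' = "?S - {0}"
  define \<mu> where "\<mu> = Min ?S'"
  obtain \<nu> where "\<nu> > 0" "steklov_eigenvalue \<nu>"
    using exists_positive_steklov_pair[OF ab] unfolding steklov_eigenvalue_iff[OF B0] by metis
  hence S'0: "?S' \<noteq> {}" by auto
  hence \<mu>: "\<mu> \<in> ?S'" unfolding \<mu>_def using fin by (intro Min_in) auto
  then obtain f where "f \<in> steklov_eigenspace \<mu>" "f \<noteq> 0" by (auto simp: steklov_eigenvalue_def)
  hence "0 < fun_dim (steklov_eigenspace \<mu>)"
    by (intro fun_dim_pos[OF finite_B]) (auto simp: steklov_eigenspace_def)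
  then obtain k where k: "fun_dim (steklov_eigenspace \<mu>) = Suc k" using gr0_implies_Suc by blast
  have "sorted_list_of_set ?S = 0 # \<mu> # sorted_list_of_set (?S' - {\<mu>})"
    using fin \<open>0 \<in> ?S\<close> S'0 min0 sorted_list_of_set_nonempty[of ?S] sorted_list_of_set_nonempty[of ?S']
    by (metis \<mu>_def empty_iff finite_Diff)
  \<comment> \<open>List indices start at 0: the block of 0 has length 1 and that of
    \<open>\<mu>\<close> has length \<open>Suc k\<close>, so index 1 is the first copy of
    \<open>\<mu>\<close>.\<close>
  hence "steklov_spectrum ! 1 = \<mu>"
    by (simp add: steklov_spectrum_def fun_dim_steklov_eigenspace_0[OF B0] k)
  hence "steklov_sigma 2 = ereal \<mu>" using assms by (simp add: steklov_sigma_def)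
  moreover have "\<mu> > 0" using \<mu> nonneg[of \<mu>] by auto
  ultimately show ?thesis using \<mu> that by (auto simp: steklov_eigenvalue_iff[OF B0])
qed

lemma steklov_sigma_2_lower_bound:
  "ereal (Min (w ` E) * (\<Sum>x\<in>B. m x) /
      (((\<Sum>x\<in>B. m x) - Min (m ` B))\<^sup>2 * real (Max {graph_dist x y | x y. x \<in> B \<and> y \<in> B})))
    \<le> steklov_sigma 2"
proof (cases "2 \<le> card B")
  case True
  then obtain \<mu> u x where "steklov_sigma 2 = ereal \<mu>" "\<mu> > 0" "steklov_pair \<mu> u" "x \<in> B" "u x \<noteq> 0"
    by (rule steklov_sigma_2_eigenvalue)
  thus ?thesis using steklov_pair_lower_bound[of \<mu> u x] by simp
\<comment> \<open>With fewer than two boundary vertices \<open>steklov_sigma 2\<close> is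
  infinite.\<close>
qed (simp add: steklov_sigma_def)

end

theorem theorem1p3:
  fixes V :: "'a set" and E :: "'a set set" and B :: "'a set"
    and m :: "'a \<Rightarrow> real" and w :: "'a set \<Rightarrow> real"
  assumes "finite_connected_boundary_graph V E B m w"
  shows "let V_B = (\<Sum>x\<in>B. m x);
             m_0 = Min (m ` B);
             w_0 = Min (w ` E);
             d_B = Max {finite_boundary_graph.graph_dist V E x y | x y. x \<in> B \<and> y \<in> B}
         in finite_boundary_graph.steklov_sigma V E B m w 2
              \<ge> ereal (w_0 * V_B / ((V_B - m_0)\<^sup>2 * real d_B))"
  using finite_connected_boundary_graph.steklov_sigma_2_lower_bound[OF assms]
  by (simp only: Let_def)

end
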